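(* Let $n$ be a positive integer and let $s,t$ be primes satisfying $n-\varphi(n)<s<t$ and $s\equiv \pm t \pmod n$. Then $V_{ns}=\pm V_{nt}$, where the same sign is taken in both occurrences of $\pm$ (i.e. if $s\equiv t\pmod n$ then $V_{ns}=V_{nt}$, and if $s\equiv -t\pmod n$ then $V_{ns}=-V_{nt}$).
   Context: $\Phi_m(x)$ denotes the $m$th cyclotomic polynomial and $\varphi$ is Euler's totient. For a polynomial $f\in\mathbb Z[x]$, $V(f)=\{[x^k]f(x): k\in\mathbb Z\}$ is the set of its coefficients, including $0$ (where $[x^k]f$ is the coefficient of $x^k$, zero if $k<0$ or $k>\deg f$), and $V_m:=V(\Phi_m(x))$. For a set $S$ of integers, $-S=\{-a:a\in S\}$.
   Formalization: For n = 1 only the plus-sign claim is stated; the claim that s ≡ -t (mod n) implies V_{ns} = -V_{nt} is stated for n ≥ 2, since for n = 1 it always fails: V_s = V_t = {0,1}, whereas -V_t = {0,-1}. *)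

theory Defs
  imports
    "HOL-Computational_Algebra.Computational_Algebra"
    "HOL-Number_Theory.Cong"
    "HOL-Number_Theory.Totient"
begin

definition primitive_roots_of_unity :: "nat \<Rightarrow> complex set" where
  "primitive_roots_of_unity m = {z. z ^ m = 1 \<and> (\<forall>k. 0 < k \<and> k < m \<longrightarrow> z ^ k \<noteq> 1)}"

definition complex_cyclotomic :: "nat \<Rightarrow> complex poly" where
  "complex_cyclotomic m = (\<Prod>z\<in>primitive_roots_of_unity m. [:- z, 1:])"

text \<open>
  The polynomial \<open>\<Phi>\<^sub>m\<close> as an element of \<open>\<int>[x]\<close>; existence and uniqueness (for \<open>m > 0\<close>)
  are established in \<open>map_poly_cyclotomic\<close> and \<open>cyclotomic_unique\<close> below.
\<close>
definition cyclotomic :: "nat \<Rightarrow> int poly" where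
  "cyclotomic m = (THE p. map_poly of_int p = complex_cyclotomic m)"

text \<open>
  \<open>coeff f k\<close> is \<open>0\<close> for every \<open>k > degree f\<close>, so \<open>0\<close> is always an element; letting
  \<open>k\<close> also range over the negative integers would add nothing.
\<close>
definition coeff_set :: "int poly \<Rightarrow> int set" where
  "coeff_set f = range (coeff f)"

lemma map_poly_of_int_mult:
  "map_poly (of_int :: int \<Rightarrow> complex) (p * q) = map_poly of_int p * map_poly of_int q"
  by (intro poly_eqI) (simp add: coeff_map_poly coeff_mult)

lemma map_poly_of_int_add:
  "map_poly (of_int :: int \<Rightarrow> complex) (p + q) = map_poly of_int p + map_poly of_int q"
  by (intro poly_eqI) (simp add: coeff_map_poly)

lemma map_poly_of_int_eq_iff:
  "map_poly (of_int :: int \<Rightarrow> complex) p = map_poly of_int q \<longleftrightarrow> p = q"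
  by (auto simp: poly_eq_iff coeff_map_poly)

lemma degree_map_poly_of_int: "degree (map_poly (of_int :: int \<Rightarrow> complex) p) = degree p"
  by (rule degree_map_poly) auto

lemma lead_coeff_prod_linear: "lead_coeff (\<Prod>z\<in>A. [:- z, 1:: complex:]) = 1"
  by (simp add: lead_coeff_prod)

lemma finite_primitive_roots_of_unity:
  assumes "m > 0"
  shows "finite (primitive_roots_of_unity m)"
  by (rule finite_subset[OF _ finite_roots_unity[of m]])
     (use assms in \<open>auto simp: primitive_roots_of_unity_def\<close>)

lemma primitive_root_of_unity_dvd:
  assumes "z \<in> primitive_roots_of_unity d" "d > 0" "z ^ n = 1"
  shows "d dvd n"
proof -
  have "z ^ n = (z ^ d) ^ (n div d) * z ^ (n mod d)"
    by (metis mult_div_mod_eq power_add power_mult)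
  hence "z ^ (n mod d) = 1"
    using assms by (simp add: primitive_roots_of_unity_def)
  moreover have "n mod d < d" using assms by simp
  ultimately have "n mod d = 0"
    using assms(1) by (auto simp: primitive_roots_of_unity_def)
  thus ?thesis by auto
qed

lemma roots_unity_eq_Union:
  assumes "n > 0"
  shows "{z. z ^ n = 1} = (\<Union>d\<in>{d. d dvd n}. primitive_roots_of_unity d)"
proof (intro equalityI subsetI)
  fix z :: complex assume "z \<in> {z. z ^ n = 1}"
  hence z: "z ^ n = 1" by simp
  define d where "d = (LEAST k. 0 < k \<and> z ^ k = 1)"
  have d: "0 < d \<and> z ^ d = 1"
    unfolding d_def by (rule LeastI[of _ n]) (use assms z in auto)
  have "z ^ k \<noteq> 1" if "0 < k" "k < d" for k
    using that not_less_Least[of k "\<lambda>k. 0 < k \<and> z ^ k = 1"] unfolding d_def by blast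
  hence "z \<in> primitive_roots_of_unity d"
    using d by (auto simp: primitive_roots_of_unity_def)
  moreover from this have "d dvd n"
    using d z by (blast intro: primitive_root_of_unity_dvd)
  ultimately show "z \<in> (\<Union>d\<in>{d. d dvd n}. primitive_roots_of_unity d)" by blast
next
  fix z assume "z \<in> (\<Union>d\<in>{d. d dvd n}. primitive_roots_of_unity d)"
  thus "z \<in> {z. z ^ n = 1}"
    by (auto simp: primitive_roots_of_unity_def elim!: dvdE simp: power_mult)
qed

lemma prod_complex_cyclotomic:
  assumes "n > 0"
  shows "(\<Prod>d | d dvd n. complex_cyclotomic d) = monom 1 n - 1"
proof -
  define p where "p = (monom 1 n - 1 :: complex poly)"
  have roots: "{z. poly p z = 0} = {z. z ^ n = 1}"
    by (simp add: p_def poly_monom)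
  have "rsquarefree p"
    unfolding rsquarefree_roots
    using assms by (auto simp: p_def poly_monom pderiv_diff pderiv_monom power_0_left)
  moreover have "lead_coeff p = 1"
  proof -
    have "degree p = n"
      using assms degree_add_eq_left[of "- 1" "monom (1 :: complex) n"]
      by (simp add: p_def degree_monom_eq)
    thus ?thesis using assms by (simp add: p_def coeff_1)
  qed
  ultimately have "p = (\<Prod>z | z ^ n = 1. [:- z, 1:])"
    using complex_poly_decompose_rsquarefree[of p] roots by simp
  also have "\<dots> = (\<Prod>z\<in>(\<Union>d\<in>{d. d dvd n}. primitive_roots_of_unity d). [:- z, 1:])"
    by (simp only: roots_unity_eq_Union[OF assms])
  also have "\<dots> = (\<Prod>d | d dvd n. \<Prod>z\<in>primitive_roots_of_unity d. [:- z, 1:])"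
  proof (rule prod.UNION_disjoint)
    show "finite {d. d dvd n}" using assms by simp
    show "\<forall>d\<in>{d. d dvd n}. finite (primitive_roots_of_unity d)"
      using assms by (auto intro!: finite_primitive_roots_of_unity intro: Nat.gr0I)
    show "\<forall>d\<in>{d. d dvd n}. \<forall>e\<in>{d. d dvd n}. d \<noteq> e \<longrightarrow>
            primitive_roots_of_unity d \<inter> primitive_roots_of_unity e = {}"
    proof (intro ballI impI, rule ccontr)
      fix d e assume *: "d \<in> {d. d dvd n}" "e \<in> {d. d dvd n}" "d \<noteq> e"
        "primitive_roots_of_unity d \<inter> primitive_roots_of_unity e \<noteq> {}"
      then obtain z where "z \<in> primitive_roots_of_unity d" "z \<in> primitive_roots_of_unity e"
        by blast
      moreover from this have "z ^ d = 1" "z ^ e = 1"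
        by (auto simp: primitive_roots_of_unity_def)
      moreover have "d > 0" "e > 0" using * assms by (auto intro: Nat.gr0I)
      ultimately have "d dvd e" "e dvd d" by (auto intro: primitive_root_of_unity_dvd)
      with * show False by (simp add: dvd_antisym)
    qed
  qed
  finally show ?thesis by (simp add: p_def complex_cyclotomic_def)
qed

lemma integral_monic_quotient:
  fixes P Q :: "int poly" and R :: "complex poly"
  assumes "map_poly of_int P = map_poly of_int Q * R" "lead_coeff Q = 1"
  shows "\<exists>q. map_poly of_int q = R"
proof -
  obtain q r where qr: "pseudo_divmod P Q = (q, r)" by force
  have Q: "Q \<noteq> 0" using assms(2) by auto
  from pseudo_divmod[OF Q qr] assms(2)
  have *: "P = Q * q + r" "r = 0 \<or> degree r < degree Q" by auto
  define c :: "int poly \<Rightarrow> complex poly" where "c = map_poly of_int"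
  have "c Q * R = c Q * c q + c r"
    using assms(1) *(1) by (simp add: c_def map_poly_of_int_mult map_poly_of_int_add)
  hence eq: "c Q * (R - c q) = c r" by (simp add: algebra_simps)
  have "R - c q = 0"
  proof (rule ccontr)
    assume ne: "R - c q \<noteq> 0"
    have cQ: "c Q \<noteq> 0" using Q map_poly_of_int_eq_iff[of Q 0] by (simp add: c_def)
    hence "c r \<noteq> 0" using ne eq by (metis mult_eq_0_iff)
    hence "degree r < degree Q" using *(2) by (auto simp: c_def)
    moreover have "degree (c r) = degree (c Q) + degree (R - c q)"
      unfolding eq[symmetric] using cQ ne by (rule degree_mult_eq)
    ultimately show False by (simp add: c_def degree_map_poly_of_int)
  qed
  thus ?thesis by (auto simp: c_def)
qed

lemma complex_cyclotomic_integral: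
  assumes "n > 0"
  shows "\<exists>p. map_poly of_int p = complex_cyclotomic n"
  using assms
proof (induction n rule: less_induct)
  case (less n)
  define D where "D = {d. d dvd n} - {n}"
  have fin: "finite D" using less.prems by (simp add: D_def)
  have "\<forall>d\<in>D. \<exists>p. map_poly of_int p = complex_cyclotomic d"
  proof
    fix d assume "d \<in> D"
    hence "d < n" "d > 0"
      using less.prems by (auto simp: D_def dest: dvd_imp_le intro: Nat.gr0I le_neq_implies_less)
    thus "\<exists>p. map_poly of_int p = complex_cyclotomic d" by (rule less.IH)
  qed
  then obtain f where f: "\<And>d. d \<in> D \<Longrightarrow> map_poly of_int (f d) = complex_cyclotomic d"
    by metis
  define Q where "Q = (\<Prod>d\<in>D. f d)"
  have Q: "map_poly of_int Q = (\<Prod>d\<in>D. complex_cyclotomic d)"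
    unfolding Q_def using fin f
    by (induction D rule: finite_induct) (auto simp: map_poly_of_int_mult)
  have "lead_coeff (map_poly (of_int :: int \<Rightarrow> complex) Q) = 1"
    unfolding Q lead_coeff_prod
    by (intro prod.neutral) (auto simp: complex_cyclotomic_def lead_coeff_prod_linear)
  hence "lead_coeff Q = 1"
    by (simp add: degree_map_poly_of_int coeff_map_poly)
  moreover have "map_poly of_int (monom 1 n - 1) = map_poly of_int Q * complex_cyclotomic n"
  proof -
    have "map_poly of_int (monom 1 n - 1) = (monom 1 n - 1 :: complex poly)"
      by (intro poly_eqI) (simp add: coeff_map_poly coeff_1)
    also have "\<dots> = (\<Prod>d | d dvd n. complex_cyclotomic d)"
      by (rule prod_complex_cyclotomic[OF less.prems, symmetric])
    also have "\<dots> = complex_cyclotomic n * (\<Prod>d\<in>D. complex_cyclotomic d)"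
      unfolding D_def using less.prems by (intro prod.remove) auto
    finally show ?thesis by (simp add: Q mult.commute)
  qed
  ultimately show ?case by (rule integral_monic_quotient[rotated])
qed

lemma map_poly_cyclotomic:
  assumes "m > 0"
  shows "map_poly of_int (cyclotomic m) = complex_cyclotomic m"
proof -
  obtain p where p: "map_poly of_int p = complex_cyclotomic m"
    using complex_cyclotomic_integral[OF assms] by blast
  have "cyclotomic m = p"
    unfolding cyclotomic_def by (rule the_equality) (auto simp: p map_poly_of_int_eq_iff simp flip: p)
  with p show ?thesis by simp
qed

lemma cyclotomic_unique:
  assumes "map_poly of_int p = complex_cyclotomic m"
  shows "cyclotomic m = p"
  unfolding cyclotomic_def
  by (rule the_equality) (auto simp: assms map_poly_of_int_eq_iff simp flip: assms)

end

theory Submission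
  imports Defs
begin

text \<open>
  The congruence forces \<open>s\<close> and \<open>t\<close> not to divide \<open>n\<close>, so \<open>\<Phi>\<^bsub>ns\<^esub>(x) = \<Phi>\<^sub>n(x ^ s) / \<Phi>\<^sub>n(x)\<close>.
  As the power series \<open>1 / \<Phi>\<^sub>n\<close> has coefficients \<open>c\<close> of period \<open>n\<close>, the coefficients of
  \<open>\<Phi>\<^bsub>ns\<^esub>\<close> are partial sums \<open>\<Sum>j<q. a\<^sub>j c(r - j s)\<close>, where \<open>a\<^sub>j\<close> are the coefficients of \<open>\<Phi>\<^sub>n\<close>.
  The bound on \<open>s\<close> ensures that all pairs \<open>(q, r)\<close> contribute, and the set of all such sums depends
  only on \<open>s\<close> modulo \<open>n\<close>. The complete sums over \<open>j\<close> vanish and \<open>\<Phi>\<^sub>n\<close> is palindromic for \<open>n > 1\<close>,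
  so replacing \<open>s\<close> by \<open>-s\<close> negates this set.
\<close>

section \<open>Divisor products, degree and symmetry of cyclotomic polynomials\<close>

text \<open>Uniqueness in multiplicative Moebius inversion: by strong induction the factors at
  proper divisors agree, and being nonzero they cancel. Identities between cyclotomic polynomials
  thus reduce to identities for \<open>x ^ m - 1\<close>.\<close>

lemma prod_divisors_eq_imp_eq:
  fixes f g :: "nat \<Rightarrow> 'a :: idom"
  assumes "n > 0"
    and "\<And>m. m dvd n \<Longrightarrow> (\<Prod>d | d dvd m. f d) = (\<Prod>d | d dvd m. g d)"
    and "\<And>d. d dvd n \<Longrightarrow> g d \<noteq> 0"
  shows "f n = g n"
  using assms
proof (induction n rule: less_induct)
  case (less n)
  let ?D = "{d. d dvd n} - {n}"
  have fin: "finite {d. d dvd n}" using less.prems(1) by simp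
  have eq: "f d = g d" if "d \<in> ?D" for d
  proof (rule less.IH)
    show "d < n" "d > 0" using that less.prems(1)
      by (auto dest: dvd_imp_le intro: Nat.gr0I le_neq_implies_less)
  qed (use that less.prems in \<open>auto intro: dvd_trans\<close>)
  have "f n * prod g ?D = f n * prod f ?D"
    using eq by simp
  also have "\<dots> = (\<Prod>d | d dvd n. f d)"
    using fin by (subst prod.remove[of _ n]) auto
  also have "\<dots> = (\<Prod>d | d dvd n. g d)"
    using less.prems(2) by simp
  also have "\<dots> = g n * prod g ?D"
    using fin by (subst prod.remove[of _ n]) auto
  finally show ?case
    using less.prems(3) fin by auto
qed

lemma prod_cyclotomic:
  assumes "n > 0"
  shows "(\<Prod>d | d dvd n. cyclotomic d) = monom 1 n - 1"
proof -
  have "map_poly of_int (prod cyclotomic A) = prod complex_cyclotomic A"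
    if "finite A" "0 \<notin> A" for A
    using that
    by (induction A rule: finite_induct) (auto simp: map_poly_of_int_mult map_poly_cyclotomic)
  from this[of "{d. d dvd n}"] assms
  have "map_poly of_int (\<Prod>d | d dvd n. cyclotomic d) = (monom 1 n - 1 :: complex poly)"
    by (simp add: prod_complex_cyclotomic)
  also have "\<dots> = map_poly of_int (monom 1 n - 1)"
    by (intro poly_eqI) (simp add: coeff_map_poly coeff_1)
  finally show ?thesis
    by (simp only: map_poly_of_int_eq_iff)
qed

lemma degree_monom_diff_1:
  "n > 0 \<Longrightarrow> degree (monom 1 n - 1 :: 'a :: comm_ring_1 poly) = n"
  using degree_add_eq_left[of "- 1" "monom (1 :: 'a) n"] by (simp add: degree_monom_eq)

lemma cyclotomic_nonzero:
  assumes "n > 0"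
  shows "cyclotomic n \<noteq> 0"
proof
  assume "cyclotomic n = 0"
  hence "(\<Prod>d | d dvd n. cyclotomic d) = 0"
    using assms by (intro prod_zero bexI[of _ n]) auto
  with prod_cyclotomic[OF assms] degree_monom_diff_1[OF assms, where 'a = int] assms
  show False by simp
qed

lemma degree_cyclotomic:
  assumes "n > 0"
  shows "degree (cyclotomic n) = totient n"
proof -
  \<comment> \<open>Powers of 2 turn the divisor sums of degrees and totients into products.\<close>
  have "(2 :: int) ^ degree (cyclotomic n) = 2 ^ totient n"
  proof (rule prod_divisors_eq_imp_eq[OF assms])
    fix m assume "m dvd n"
    with assms have m: "m > 0" by (auto intro: Nat.gr0I)
    have "(\<Sum>d | d dvd m. degree (cyclotomic d)) = degree (\<Prod>d | d dvd m. cyclotomic d)"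
      using m by (intro degree_prod_sum_eq[symmetric]) (auto intro!: cyclotomic_nonzero intro: Nat.gr0I)
    also have "\<dots> = (\<Sum>d | d dvd m. totient d)"
      using m by (simp add: prod_cyclotomic degree_monom_diff_1 totient_divisor_sum)
    finally show "(\<Prod>d | d dvd m. (2 :: int) ^ degree (cyclotomic d)) = (\<Prod>d | d dvd m. 2 ^ totient d)"
      by (simp flip: power_sum)
  qed auto
  thus ?thesis by simp
qed

lemma reflect_poly_monom_diff_1:
  assumes "n > 0"
  shows "reflect_poly (monom 1 n - 1 :: 'a :: comm_ring_1 poly) = 1 - monom 1 n"
proof (rule poly_eqI)
  fix k show "coeff (reflect_poly (monom 1 n - 1)) k = coeff (1 - monom 1 n :: 'a poly) k"
    using assms by (auto simp: coeff_reflect_poly degree_monom_diff_1 coeff_1)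
qed

lemma reflect_poly_cyclotomic:
  assumes "n > 1"
  shows "reflect_poly (cyclotomic n) = cyclotomic n"
proof -
  \<comment> \<open>Reflection negates \<open>x ^ m - 1\<close>; the sign is absorbed by the factor
    at \<open>d = 1\<close>, since \<open>x - 1\<close> is antipalindromic.\<close>
  define g where "g d = (if d = 1 then - cyclotomic d else cyclotomic d)" for d
  have "reflect_poly (cyclotomic n) = g n"
  proof (rule prod_divisors_eq_imp_eq)
    fix m assume "m dvd n"
    with assms have m: "m > 0" by (auto intro: Nat.gr0I)
    have "(\<Prod>d | d dvd m. reflect_poly (cyclotomic d)) = reflect_poly (\<Prod>d | d dvd m. cyclotomic d)"
      by (simp add: reflect_poly_prod)
    also have "\<dots> = - (\<Prod>d | d dvd m. cyclotomic d)"
      using m by (simp add: prod_cyclotomic reflect_poly_monom_diff_1)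
    also have "\<dots> = g 1 * (\<Prod>d \<in> {d. d dvd m} - {1}. cyclotomic d)"
      using m by (subst prod.remove[of _ 1]) (auto simp: g_def)
    also have "(\<Prod>d \<in> {d. d dvd m} - {1}. cyclotomic d) = (\<Prod>d \<in> {d. d dvd m} - {1}. g d)"
      by (intro prod.cong) (auto simp: g_def)
    also have "g 1 * \<dots> = (\<Prod>d | d dvd m. g d)"
      using m by (subst prod.remove[of _ 1]) auto
    finally show "(\<Prod>d | d dvd m. reflect_poly (cyclotomic d)) = (\<Prod>d | d dvd m. g d)" .
  qed (use assms in \<open>auto simp: g_def intro!: cyclotomic_nonzero intro: Nat.gr0I\<close>)
  thus ?thesis using assms by (simp add: g_def)
qed

lemma coeff_cyclotomic_palindromic:
  assumes "n > 1" "j \<le> totient n"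
  shows "coeff (cyclotomic n) (totient n - j) = coeff (cyclotomic n) j"
  using arg_cong[OF reflect_poly_cyclotomic[OF assms(1)], of "\<lambda>p. coeff p j"] assms
  by (simp add: coeff_reflect_poly degree_cyclotomic)

section \<open>Substituting \<open>x ^ s\<close> and passing from \<open>n\<close> to
  \<open>n * s\<close>\<close>

lemma pcompose_monom: "pcompose (monom a n) p = smult a (p ^ n)"
  by (induction n) (auto simp: monom_0 monom_Suc pcompose_pCons)

lemma coeff_pcompose_monom:
  fixes p :: "'a :: comm_semiring_1 poly"
  assumes "s > 0"
  shows "coeff (pcompose p (monom 1 s)) i = (if s dvd i then coeff p (i div s) else 0)"
proof (induction p arbitrary: i rule: pCons_induct)
  case (pCons a p)
  show ?case
    using assms
    by (auto simp: pcompose_pCons coeff_monom_mult pCons.IH coeff_pCons dvd_imp_le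
        dvd_minus_self le_div_geq not_le div_eq_0_iff split: nat.splits)
qed simp

lemma divisors_mult_prime:
  fixes m s :: nat
  assumes "prime s"
  shows "{d. d dvd m * s} = {d. d dvd m} \<union> (\<lambda>d. d * s) ` {d. d dvd m}"
proof (intro equalityI subsetI)
  fix d assume d: "d \<in> {d. d dvd m * s}"
  show "d \<in> {d. d dvd m} \<union> (\<lambda>d. d * s) ` {d. d dvd m}"
  proof (cases "s dvd d")
    case True
    then obtain e where "d = e * s" by (metis dvd_div_mult_self)
    thus ?thesis using d assms by auto
  next
    case False
    hence "coprime d s" using assms by (metis prime_imp_coprime coprime_commute)
    thus ?thesis using d by (simp add: coprime_dvd_mult_left_iff)
  qed
qed auto

text \<open>For \<open>m dvd n\<close> both divisor products equal \<open>x ^ (m * s) - 1\<close>: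
  since \<open>s\<close> does not divide \<open>m\<close>, the divisors of \<open>m * s\<close> are
  the disjoint union of the \<open>d\<close> and the \<open>d * s\<close> with
  \<open>d dvd m\<close>.\<close>

lemma cyclotomic_mult_prime:
  assumes "n > 0" "prime s" "\<not> s dvd n"
  shows "cyclotomic (n * s) * cyclotomic n = pcompose (cyclotomic n) (monom 1 s)"
proof (rule prod_divisors_eq_imp_eq[OF assms(1)])
  have s: "s > 0" using assms(2) by (rule prime_gt_0_nat)
  fix m assume "m dvd n"
  hence m: "m > 0" "\<not> s dvd m" using assms by (auto intro: Nat.gr0I dvd_trans)
  have "(\<Prod>d | d dvd m. cyclotomic (d * s) * cyclotomic d) =
      (\<Prod>d \<in> (\<lambda>d. d * s) ` {d. d dvd m}. cyclotomic d) * (\<Prod>d | d dvd m. cyclotomic d)"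
    using s by (subst prod.reindex) (auto simp: inj_on_def prod.distrib)
  also have "\<dots> = (\<Prod>d | d dvd m * s. cyclotomic d)"
    unfolding divisors_mult_prime[OF assms(2)] using m
    by (subst prod.union_disjoint) (auto simp: mult.commute dest: dvd_mult_left dvd_mult_right)
  also have "\<dots> = pcompose (monom 1 m - 1) (monom 1 s)"
    using m s by (simp add: prod_cyclotomic pcompose_diff pcompose_monom monom_power mult.commute pcompose_1)
  also have "\<dots> = (\<Prod>d | d dvd m. pcompose (cyclotomic d) (monom 1 s))"
    using m by (simp add: pcompose_prod flip: prod_cyclotomic)
  finally show "(\<Prod>d | d dvd m. cyclotomic (d * s) * cyclotomic d) =
     (\<Prod>d | d dvd m. pcompose (cyclotomic d) (monom 1 s))" .
next
  fix d assume "d dvd n"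
  hence "cyclotomic d \<noteq> 0"
    using assms by (intro cyclotomic_nonzero) (auto intro: Nat.gr0I)
  thus "pcompose (cyclotomic d) (monom 1 s) \<noteq> 0"
    using assms(2) by (subst pcompose_eq_0_iff) (auto simp: degree_monom_eq prime_gt_0_nat)
qed

section \<open>The power series inverse of a cyclotomic polynomial\<close>

text \<open>This is the inverse cyclotomic polynomial \<open>(x ^ n - 1) / \<Phi>\<^sub>n\<close>,
  written as a product to avoid polynomial division.\<close>

definition cyclotomic_cofactor :: "nat \<Rightarrow> int poly" where
  "cyclotomic_cofactor n = (\<Prod>d \<in> {d. d dvd n} - {n}. cyclotomic d)"

lemma cyclotomic_times_cofactor:
  assumes "n > 0"
  shows "cyclotomic n * cyclotomic_cofactor n = monom 1 n - 1"
  unfolding prod_cyclotomic[OF assms, symmetric] cyclotomic_cofactor_def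
  using assms by (subst prod.remove[of _ n, symmetric]) auto

lemma cyclotomic_cofactor_nonzero:
  assumes "n > 0"
  shows "cyclotomic_cofactor n \<noteq> 0"
  using cyclotomic_times_cofactor[OF assms] degree_monom_diff_1[OF assms, where 'a = int] assms
  by auto

lemma degree_cyclotomic_cofactor:
  assumes "n > 0"
  shows "degree (cyclotomic_cofactor n) = n - totient n"
  using degree_mult_eq[OF cyclotomic_nonzero cyclotomic_cofactor_nonzero, OF assms assms] assms
  by (simp add: cyclotomic_times_cofactor degree_monom_diff_1 degree_cyclotomic)

text \<open>
  Since \<open>1 / \<Phi>\<^sub>n = - \<Psi>\<^sub>n / (1 - x ^ n)\<close> for the cofactor \<open>\<Psi>\<^sub>n\<close> of \<open>\<Phi>\<^sub>n\<close>, and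
  \<open>degree \<Psi>\<^sub>n < n\<close>, the power series coefficients of \<open>1 / \<Phi>\<^sub>n\<close> are periodic; here
  the periodic sequence is extended to negative indices.
\<close>
definition inverse_coeff :: "nat \<Rightarrow> int \<Rightarrow> int" where
  "inverse_coeff n k = - coeff (cyclotomic_cofactor n) (nat (k mod int n))"

lemma inverse_coeff_cong:
  "[k = l] (mod int n) \<Longrightarrow> inverse_coeff n k = inverse_coeff n l"
  by (simp add: inverse_coeff_def cong_def)

text \<open>The cofactor has degree \<open>n - totient n\<close>, so each period vanishes past that
  residue. The lower bound on \<open>s\<close> enters through this fact.\<close>

lemma inverse_coeff_eq_0:
  assumes "n > 0" "int (n - totient n) < k mod int n"
  shows "inverse_coeff n k = 0"
  using assms unfolding inverse_coeff_def
  by (subst coeff_eq_0) (auto simp: degree_cyclotomic_cofactor)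

lemma inverse_coeff_mult_cyclotomic:
  assumes "n > 0"
  shows "Abs_fps (\<lambda>k. inverse_coeff n (int k)) * fps_of_poly (cyclotomic n) = 1"
proof -
  let ?C = "Abs_fps (\<lambda>k. inverse_coeff n (int k))" and ?P = "fps_of_poly (cyclotomic_cofactor n)"
  \<comment> \<open>The factor \<open>x ^ n - 1\<close> cancels the periodic tail and leaves the
    negated first period, which is the cofactor.\<close>
  have "?C * (fps_X ^ n - 1) = ?P"
  proof (rule fps_ext)
    fix k
    show "(?C * (fps_X ^ n - 1)) $ k = ?P $ k"
    proof (cases "k < n")
      case False
      have "degree (cyclotomic_cofactor n) < n"
        using assms by (simp add: degree_cyclotomic_cofactor)
      moreover have "inverse_coeff n (int (k - n)) = inverse_coeff n (int k)"
        using False by (intro inverse_coeff_cong) (auto simp: cong_def of_nat_diff)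
      ultimately show ?thesis using False
        by (simp add: right_diff_distrib fps_X_power_mult_right_nth coeff_eq_0)
    qed (simp add: right_diff_distrib fps_X_power_mult_right_nth inverse_coeff_def)
  qed
  moreover have "fps_X ^ n - 1 = fps_of_poly (cyclotomic n) * ?P"
    using cyclotomic_times_cofactor[OF assms]
    by (simp add: fps_of_poly_diff fps_of_poly_monom' flip: fps_of_poly_mult)
  ultimately have "(?C * fps_of_poly (cyclotomic n)) * ?P = 1 * ?P"
    by (simp add: mult.assoc)
  moreover have "?P \<noteq> 0"
    using cyclotomic_cofactor_nonzero[OF assms] by simp
  ultimately show ?thesis by (simp only: mult_cancel_right) simp
qed

section \<open>Coefficients as partial sums\<close>

text \<open>The cutoff \<open>q\<close> is kept independent of \<open>r\<close>; \<open>s\<close>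
  and \<open>r\<close> are integers so that both can be replaced modulo \<open>n\<close> and
  \<open>s\<close> can be negated.\<close>

definition partial_coeff :: "nat \<Rightarrow> int \<Rightarrow> nat \<Rightarrow> int \<Rightarrow> int" where
  "partial_coeff n s q r = (\<Sum>j<q. coeff (cyclotomic n) j * inverse_coeff n (r - int j * s))"

lemma partial_coeff_cong:
  assumes "[s = t] (mod int n)" "[r = u] (mod int n)"
  shows "partial_coeff n s q r = partial_coeff n t q u"
  unfolding partial_coeff_def
  by (intro sum.cong refl arg_cong2[where f = "(*)"] inverse_coeff_cong cong_diff cong_mult assms)
     auto

text \<open>In the product of \<open>\<Phi>\<^sub>n(x ^ s)\<close> with the series of
  \<open>1 / \<Phi>\<^sub>n\<close>, only the exponents \<open>j * s\<close> with
  \<open>j \<le> k div s\<close> contribute.\<close>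

lemma coeff_cyclotomic_mult_prime:
  assumes "n > 0" "prime s" "\<not> s dvd n"
  shows "coeff (cyclotomic (n * s)) k = partial_coeff n (int s) (Suc (k div s)) (int k)"
proof -
  let ?C = "Abs_fps (\<lambda>k. inverse_coeff n (int k))"
  let ?A = "pcompose (cyclotomic n) (monom 1 s)"
  have s: "s > 0" using assms(2) by (rule prime_gt_0_nat)
  have "fps_of_poly (cyclotomic (n * s)) = 
      fps_of_poly (cyclotomic (n * s)) * (?C * fps_of_poly (cyclotomic n))"
    by (simp add: inverse_coeff_mult_cyclotomic[OF assms(1)])
  also have "\<dots> = fps_of_poly ?A * ?C"
    by (simp add: fps_of_poly_mult mult_ac flip: cyclotomic_mult_prime[OF assms])
  finally have "coeff (cyclotomic (n * s)) k = (fps_of_poly ?A * ?C) $ k"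
    by (metis fps_of_poly_nth)
  also have "\<dots> = (\<Sum>i=0..k. coeff ?A i * inverse_coeff n (int k - int i))"
    by (auto simp: fps_mult_nth of_nat_diff intro!: sum.cong)
  also have "\<dots> = (\<Sum>i \<in> (\<lambda>j. j * s) ` {..<Suc (k div s)}. coeff ?A i * inverse_coeff n (int k - int i))"
  proof (rule sum.mono_neutral_right)
    show "(\<lambda>j. j * s) ` {..<Suc (k div s)} \<subseteq> {0..k}"
      using s by (auto simp: less_Suc_eq_le less_eq_div_iff_mult_less_eq)
    show "\<forall>i\<in>{0..k} - (\<lambda>j. j * s) ` {..<Suc (k div s)}. coeff ?A i * inverse_coeff n (int k - int i) = 0"
    proof
      fix i assume i: "i \<in> {0..k} - (\<lambda>j. j * s) ` {..<Suc (k div s)}"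
      have "\<not> s dvd i"
      proof
        assume "s dvd i"
        hence "i = (i div s) * s" by simp
        moreover have "i div s < Suc (k div s)" using i by (auto simp: less_Suc_eq_le div_le_mono)
        ultimately show False using i by blast
      qed
      thus "coeff ?A i * inverse_coeff n (int k - int i) = 0"
        using s by (simp add: coeff_pcompose_monom)
    qed
  qed simp
  also have "\<dots> = partial_coeff n (int s) (Suc (k div s)) (int k)"
    unfolding partial_coeff_def using s
    by (subst sum.reindex) (auto simp: inj_on_def coeff_pcompose_monom)
  finally show ?thesis .
qed

lemma partial_coeff_extend:
  assumes "n > 0" "q \<ge> Suc (totient n)"
  shows "partial_coeff n s q r = partial_coeff n s (Suc (totient n)) r"
  unfolding partial_coeff_def using assms
  by (intro sum.mono_neutral_right) (auto simp: coeff_eq_0 degree_cyclotomic)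

text \<open>A complete sum depends on \<open>r\<close> only modulo \<open>n\<close>, so it equals a
  coefficient of \<open>cyclotomic (n * s)\<close> beyond the degree.\<close>

lemma partial_coeff_complete:
  assumes "n > 0" "prime s" "\<not> s dvd n" "q > totient n"
  shows "partial_coeff n (int s) q r = 0"
proof -
  \<comment> \<open>The multiple of \<open>n\<close> added to the residue of \<open>r\<close> is so
    large that \<open>k div s\<close> reaches \<open>totient n\<close> and \<open>k\<close> exceeds
    the degree.\<close>
  define k where
    "k = nat (r mod int n) + n * (s * totient n + degree (cyclotomic (n * s)) + 1)"
  have s: "s > 0" using assms(2) by (rule prime_gt_0_nat)
  have mono: "m \<le> n * m" for m using assms(1) by simp
  have k: "s * totient n \<le> k" "degree (cyclotomic (n * s)) < k"
    unfolding k_def using mono[of "s * totient n + degree (cyclotomic (n * s)) + 1"] by linarith+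
  have "totient n \<le> k div s"
    using s k(1) by (simp add: less_eq_div_iff_mult_less_eq mult.commute)
  hence "partial_coeff n (int s) (Suc (totient n)) (int k) = coeff (cyclotomic (n * s)) k"
    using partial_coeff_extend[of n "Suc (k div s)" "int s" "int k"] assms
    by (simp add: coeff_cyclotomic_mult_prime)
  also have "\<dots> = 0" using k(2) by (rule coeff_eq_0)
  finally have "partial_coeff n (int s) (Suc (totient n)) (int k) = 0" .
  moreover have "[r = int k] (mod int n)"
    using assms(1) unfolding k_def of_nat_add of_nat_mult by (simp add: cong_def)
  ultimately show ?thesis
    using partial_coeff_extend[of n q "int s" r] assms
      partial_coeff_cong[of "int s" "int s" n r "int k" "Suc (totient n)"] by simp
qed

text \<open>
  The pair \<open>(q, r)\<close> is realised by an exponent exactly if \<open>(r - (q - 1) s) mod n < s\<close>. Otherwise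
  the last summand vanishes, because \<open>\<Psi>\<^sub>n\<close> has degree \<open>n - totient n < s\<close>, so that
  \<open>q\<close> may be decreased.
\<close>
lemma coeff_set_cyclotomic_mult_prime:
  assumes "n > 0" "prime s" "\<not> s dvd n" "n - totient n < s"
  shows "coeff_set (cyclotomic (n * s)) = {partial_coeff n (int s) q r |q r. True}"
proof (intro equalityI subsetI)
  fix x assume "x \<in> coeff_set (cyclotomic (n * s))"
  thus "x \<in> {partial_coeff n (int s) q r |q r. True}"
    using assms by (auto simp: coeff_set_def coeff_cyclotomic_mult_prime)
next
  have s: "s > 0" using assms(2) by (rule prime_gt_0_nat)
  have "partial_coeff n (int s) q r \<in> coeff_set (cyclotomic (n * s))" for q r
  proof (induction q)
    case 0
    \<comment> \<open>The empty sum 0 is realised just past the degree.\<close>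
    have "coeff (cyclotomic (n * s)) (Suc (degree (cyclotomic (n * s)))) = 0"
      by (rule coeff_eq_0) simp
    thus ?case unfolding coeff_set_def partial_coeff_def by (metis lessThan_0 sum.empty rangeI)
  next
    case (Suc q)
    define m where "m = (r - int q * int s) mod int n"
    have m0: "m \<ge> 0" using assms(1) by (simp add: m_def)
    show ?case
    proof (cases "m < int s")
      case True
      define k where "k = q * s + nat m"
      have "k div s = q" using True m0 s by (simp add: k_def)
      moreover have "[int k = r] (mod int n)"
        using m0 by (simp add: k_def m_def cong_def mod_simps)
      ultimately have "partial_coeff n (int s) (Suc q) r = coeff (cyclotomic (n * s)) k"
        using assms partial_coeff_cong[of "int s" "int s" n "int k" r "Suc q"]
        by (simp add: coeff_cyclotomic_mult_prime)
      thus ?thesis by (simp add: coeff_set_def)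
    next
      case False
      hence "inverse_coeff n (r - int q * int s) = 0"
        using assms by (intro inverse_coeff_eq_0) (auto simp: m_def)
      thus ?thesis using Suc.IH by (simp add: partial_coeff_def)
    qed
  qed
  moreover fix x assume "x \<in> {partial_coeff n (int s) q r |q r. True}"
  ultimately show "x \<in> coeff_set (cyclotomic (n * s))" by blast
qed

section \<open>Negating \<open>s\<close>\<close>

text \<open>By palindromicity, replacing \<open>j\<close> by \<open>totient n - j\<close> turns the
  first \<open>q\<close> terms for \<open>-s\<close> into the last \<open>q\<close> terms for
  \<open>s\<close>, with \<open>r\<close> shifted. As the complete sum vanishes, these are minus the
  remaining initial terms.\<close>

lemma partial_coeff_uminus:
  assumes "n > 1" "prime s" "\<not> s dvd n" "q \<le> Suc (totient n)"
  shows "partial_coeff n (- int s) q r =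
    - partial_coeff n (int s) (Suc (totient n) - q) (r + int (totient n) * int s)"
proof -
  define N where "N = Suc (totient n)"
  define h where "h i = coeff (cyclotomic n) i * inverse_coeff n (r + int (totient n) * int s - int i * int s)" for i
  have "partial_coeff n (- int s) q r = (\<Sum>j<q. h (totient n - j))"
    unfolding partial_coeff_def
  proof (intro sum.cong refl)
    fix j assume "j \<in> {..<q}"
    hence "j \<le> totient n" using assms(4) by simp
    thus "coeff (cyclotomic n) j * inverse_coeff n (r - int j * - int s) = h (totient n - j)"
      using assms(1) by (simp add: h_def coeff_cyclotomic_palindromic of_nat_diff algebra_simps)
  qed
  also have "\<dots> = (\<Sum>i \<in> {N - q..<N}. h i)"
    by (rule sum.reindex_bij_witness[of _ "\<lambda>i. totient n - i" "\<lambda>i. totient n - i"])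
       (use assms(4) in \<open>auto simp: N_def\<close>)
  also have "\<dots> = (\<Sum>i<N. h i) - (\<Sum>i<N - q. h i)"
    using sum.atLeastLessThan_concat[of 0 "N - q" N h] by (simp add: lessThan_atLeast0)
  also have "(\<Sum>i<N. h i) = 0"
    using partial_coeff_complete[of n s N "r + int (totient n) * int s"] assms
    by (simp add: partial_coeff_def h_def N_def del: sum.lessThan_Suc)
  finally show ?thesis by (simp add: partial_coeff_def h_def N_def)
qed

text \<open>Terms with \<open>j > totient n\<close> vanish, so \<open>q\<close> may be capped at
  \<open>?N\<close>; the change from \<open>q\<close> to \<open>?N - q\<close> is then undone by
  repeating it and shifting \<open>r\<close> back.\<close>

lemma partial_coeff_set_uminus:
  assumes "n > 1" "prime s" "\<not> s dvd n"
  shows "{partial_coeff n (- int s) q r |q r. True} = uminus ` {partial_coeff n (int s) q r |q r. True}"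
proof -
  let ?N = "Suc (totient n)"
  have "partial_coeff n (- int s) q r \<in> uminus ` {partial_coeff n (int s) q r |q r. True}" for q r
  proof -
    have "partial_coeff n (- int s) q r = partial_coeff n (- int s) (min q ?N) r"
      using assms(1) partial_coeff_extend[of n q "- int s" r] by (auto simp: min_def)
    thus ?thesis using partial_coeff_uminus[OF assms, of "min q ?N" r] by auto
  qed
  moreover have "- partial_coeff n (int s) q r \<in> {partial_coeff n (- int s) q r |q r. True}" for q r
  proof -
    have "- partial_coeff n (int s) q r = - partial_coeff n (int s) (min q ?N) r"
      using assms(1) partial_coeff_extend[of n q "int s" r] by (auto simp: min_def)
    also have "\<dots> = partial_coeff n (- int s) (?N - min q ?N) (r - int (totient n) * int s)"
      using partial_coeff_uminus[OF assms, of "?N - min q ?N" "r - int (totient n) * int s"] by simp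
    finally show ?thesis by blast
  qed
  ultimately show ?thesis by blast
qed

text \<open>The case \<open>n = 1\<close> must be excluded for the minus sign: every congruence
  modulo 1 holds, while both coefficient sets are \<open>{0, 1}\<close>, which differs from its
  negative.\<close>

theorem theorem6p5:
  fixes n s t :: nat
  assumes "n > 0" and "prime s" and "prime t"
    and "n - totient n < s" and "s < t"
  shows "([int s = int t] (mod int n) \<longrightarrow>
            coeff_set (cyclotomic (n * s)) = coeff_set (cyclotomic (n * t)))
       \<and> (n \<noteq> 1 \<and> [int s = - int t] (mod int n) \<longrightarrow>
            coeff_set (cyclotomic (n * s)) = uminus ` coeff_set (cyclotomic (n * t)))"
proof -
  have not_dvd: "\<not> s dvd n \<and> \<not> t dvd n"
    if "[int s = int t] (mod int n) \<or> [int s = - int t] (mod int n)"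
  proof -
    \<comment> \<open>With \<open>p\<close> equal to \<open>s\<close> or \<open>t\<close>, one of
      the two primes would divide the other, contradicting \<open>s < t\<close>.\<close>
    have *: "int p dvd int s \<longleftrightarrow> int p dvd int t" if "p dvd n" for p
    proof -
      have "[int s = int t] (mod int p) \<or> [int s = - int t] (mod int p)"
        using \<open>_ \<or> _\<close> \<open>p dvd n\<close> by (auto intro: cong_dvd_modulus)
      thus ?thesis by (metis cong_dvd_iff dvd_minus_iff)
    qed
    show ?thesis
      using *[of s] *[of t] primes_dvd_imp_eq[OF assms(2,3)] primes_dvd_imp_eq[OF assms(3,2)] assms(5)
      by auto
  qed
  have *: "coeff_set (cyclotomic (n * s)) = {partial_coeff n (int s) q r |q r. True}"
    "coeff_set (cyclotomic (n * t)) = {partial_coeff n (int t) q r |q r. True}"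
    if "\<not> s dvd n \<and> \<not> t dvd n"
    using that assms by (simp_all add: coeff_set_cyclotomic_mult_prime)
  show ?thesis
  proof (intro conjI impI)
    assume c: "[int s = int t] (mod int n)"
    show "coeff_set (cyclotomic (n * s)) = coeff_set (cyclotomic (n * t))"
      using not_dvd c by (simp add: * partial_coeff_cong[OF c cong_refl])
  next
    assume c: "n \<noteq> 1 \<and> [int s = - int t] (mod int n)"
    hence "coeff_set (cyclotomic (n * s)) = {partial_coeff n (- int t) q r |q r. True}"
      using not_dvd by (simp add: * partial_coeff_cong[OF conjunct2[OF c] cong_refl])
    also have "\<dots> = uminus ` coeff_set (cyclotomic (n * t))"
      using not_dvd c assms by (subst partial_coeff_set_uminus) (auto simp: *)
    finally show "coeff_set (cyclotomic (n * s)) = uminus ` coeff_set (cyclotomic (n * t))" .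
  qed
qed

end
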